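(* For each $n\geq 1$, $$\max_{\equiv}\ \max_{w\in S_n}\ \lvert D_R(\mathbf S_\equiv(w))\rvert=\left\lfloor\frac{2(n-1)}{3}\right\rfloor,$$ where the first maximum is over all essential lattice congruences $\equiv$ on the left weak order of the symmetric group $S_n$.
   Context: $S_n$ is the symmetric group, with simple generators $s_i=(i\;\,i+1)$, $1\le i\le n-1$; products are compositions of functions and $\ell$ is Coxeter length. The left weak order is $x\leq_L y \iff \ell(yx^{-1})=\ell(y)-\ell(x)$; it is a lattice on $S_n$. The right descent set is $D_R(w)=\{s_i:\ell(ws_i)<\ell(w)\}=\{s_i: w(i)>w(i+1)\}$. A lattice congruence on a lattice is an equivalence relation $\equiv$ such that $x_1\equiv x_2$ and $y_1\equiv y_2$ imply $x_1\wedge y_1\equiv x_2\wedge y_2$ and $x_1\vee y_1\equiv x_2\vee y_2$. It is essential (on $(S_n,\leq_L)$) if the identity $e$ forms a singleton congruence class. Every congruence class has a unique minimal element; $\pi_\downarrow^\equiv(w)$ denotes the minimal element of the class of $w$. The Coxeter stack-sorting operator is $\mathbf S_\equiv:S_n\to S_n$, $\mathbf S_\equiv(w)=w\,(\pi_\downarrow^\equiv(w))^{-1}$. *)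

theory Defs
  imports Complex_Main "HOL-Combinatorics.Permutations" "HOL-Algebra.Lattice"
begin

definition Sym :: "nat \<Rightarrow> (nat \<Rightarrow> nat) set" where
  "Sym n = {w. w permutes {1..n}}"

definition simple_gen :: "nat \<Rightarrow> nat \<Rightarrow> nat" where
  "simple_gen i = transpose i (Suc i)"

definition simple_gens :: "nat \<Rightarrow> (nat \<Rightarrow> nat) set" where
  "simple_gens n = simple_gen ` {i. 1 \<le> i \<and> i < n}"

definition word_prod :: "(nat \<Rightarrow> nat) list \<Rightarrow> nat \<Rightarrow> nat" where
  "word_prod ss = foldr (\<circ>) ss id"

definition coxeter_length :: "nat \<Rightarrow> (nat \<Rightarrow> nat) \<Rightarrow> nat" where
  "coxeter_length n w =
     (LEAST k. \<exists>ss. length ss = k \<and> set ss \<subseteq> simple_gens n \<and> word_prod ss = w)"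

(* The length difference is taken over the integers, since subtraction on nat truncates. *)
definition left_weak_le :: "nat \<Rightarrow> (nat \<Rightarrow> nat) \<Rightarrow> (nat \<Rightarrow> nat) \<Rightarrow> bool" where
  "left_weak_le n x y \<longleftrightarrow>
     int (coxeter_length n (y \<circ> inv x)) = int (coxeter_length n y) - int (coxeter_length n x)"

definition left_weak_order :: "nat \<Rightarrow> (nat \<Rightarrow> nat) gorder" where
  "left_weak_order n = \<lparr>carrier = Sym n, eq = (=), le = left_weak_le n\<rparr>"

definition right_descents :: "nat \<Rightarrow> (nat \<Rightarrow> nat) \<Rightarrow> (nat \<Rightarrow> nat) set" where
  "right_descents n w =
     {s \<in> simple_gens n. coxeter_length n (w \<circ> s) < coxeter_length n w}"

definition lattice_congruence :: "('a, 'b) gorder_scheme \<Rightarrow> ('a \<times> 'a) set \<Rightarrow> bool" where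
  "lattice_congruence L R \<longleftrightarrow>
     equiv (carrier L) R \<and>
     (\<forall>x1 x2 y1 y2. (x1, x2) \<in> R \<and> (y1, y2) \<in> R \<longrightarrow>
        (x1 \<sqinter>\<^bsub>L\<^esub> y1, x2 \<sqinter>\<^bsub>L\<^esub> y2) \<in> R \<and> (x1 \<squnion>\<^bsub>L\<^esub> y1, x2 \<squnion>\<^bsub>L\<^esub> y2) \<in> R)"

definition essential_congruence :: "nat \<Rightarrow> ((nat \<Rightarrow> nat) \<times> (nat \<Rightarrow> nat)) set \<Rightarrow> bool" where
  "essential_congruence n R \<longleftrightarrow>
     lattice_congruence (left_weak_order n) R \<and> R `` {id} = {id}"

definition pi_down ::
  "nat \<Rightarrow> ((nat \<Rightarrow> nat) \<times> (nat \<Rightarrow> nat)) set \<Rightarrow> (nat \<Rightarrow> nat) \<Rightarrow> nat \<Rightarrow> nat" where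
  "pi_down n R w =
     (THE u. u \<in> R `` {w} \<and> (\<forall>v \<in> R `` {w}. left_weak_le n v u \<longrightarrow> v = u))"

definition stack_sort ::
  "nat \<Rightarrow> ((nat \<Rightarrow> nat) \<times> (nat \<Rightarrow> nat)) set \<Rightarrow> (nat \<Rightarrow> nat) \<Rightarrow> nat \<Rightarrow> nat" where
  "stack_sort n R w = w \<circ> inv (pi_down n R w)"

end

theory Submission
  imports Defs
begin

text \<open>Left weak order is inclusion of inversion sets of positions, and inversion sets are the
  biconvex sets. For \<open>u\<close> the least element of the class of \<open>w\<close>, write \<open>x\<close> for the inverse of
  \<open>u\<close>. A right descent \<open>s\<^sub>i\<close> of \<open>w x\<close> is an ascent of \<open>x\<close> whose cover \<open>u < s\<^sub>i u\<close> is contracted,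
  while the covers below \<open>u\<close>, given by the descents of \<open>x\<close>, are not contracted. Since
  contraction is inherited by longer arcs and essential congruences contract no arc of length
  one, some value strictly between \<open>x i\<close> and \<open>x (i + 1)\<close> occurs in \<open>x\<close>; walking towards the
  nearest one meets a descent of \<open>x\<close>, and each descent is met at most once from either side. So
  there are at most twice as many contracted ascents as descents, which gives the upper bound.
  For the lower bound, identify permutations with equal right descent sets, and let \<open>w\<close> take
  its low, middle and high values at the positions congruent to 0, 1 and 2 modulo 3.\<close>

section \<open>Inversion sets and biconvex sets\<close>

definition inversions :: "nat \<Rightarrow> (nat \<Rightarrow> nat) \<Rightarrow> (nat \<times> nat) set" where
  "inversions n w = {(i, j). 1 \<le> i \<and> i < j \<and> j \<le> n \<and> w j < w i}"

definition pairs :: "nat \<Rightarrow> (nat \<times> nat) set" where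
  "pairs n = {(i, j). 1 \<le> i \<and> i < j \<and> j \<le> n}"

text \<open>The last condition is transitivity of the complement of \<open>S\<close> in
  \<open>pairs n\<close>, so the notion is preserved by complementation.\<close>

definition biconvex :: "nat \<Rightarrow> (nat \<times> nat) set \<Rightarrow> bool" where
  "biconvex n S \<longleftrightarrow> S \<subseteq> pairs n \<and> trans S \<and>
     (\<forall>i j k. (i, k) \<in> S \<and> i < j \<and> j < k \<longrightarrow> (i, j) \<in> S \<or> (j, k) \<in> S)"

lemma finite_pairs: "finite (pairs n)"
  by (rule finite_subset[of _ "{1..n} \<times> {1..n}"]) (auto simp: pairs_def)

lemma inversions_subset: "inversions n w \<subseteq> pairs n"
  by (auto simp: inversions_def pairs_def)

lemma finite_inversions: "finite (inversions n w)"
  using finite_subset[OF inversions_subset finite_pairs] .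

lemma Sym_comp: "x \<in> Sym n \<Longrightarrow> y \<in> Sym n \<Longrightarrow> x \<circ> y \<in> Sym n"
  by (simp add: Sym_def permutes_compose)

lemma Sym_inv: "x \<in> Sym n \<Longrightarrow> inv x \<in> Sym n"
  by (simp add: Sym_def permutes_inv)

lemma id_in_Sym: "id \<in> Sym n"
  by (simp add: Sym_def permutes_id)

lemma finite_Sym: "finite (Sym n)"
  by (simp add: Sym_def finite_permutations)

lemma Sym_eq_iff: "x \<in> Sym n \<Longrightarrow> x i = x j \<longleftrightarrow> i = j"
  by (metis Sym_def mem_Collect_eq permutes_inverses(2))

lemma Sym_inv_apply:
  assumes "x \<in> Sym n" shows "x (inv x i) = i" "inv x (x i) = i"
  using assms by (auto simp: Sym_def permutes_inverses)

lemma Sym_range: "x \<in> Sym n \<Longrightarrow> 1 \<le> i \<Longrightarrow> i \<le> n \<Longrightarrow> 1 \<le> x i \<and> x i \<le> n"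
  using permutes_in_image[of x "{1..n}" i] by (auto simp: Sym_def)

text \<open>\<open>w\<close> maps the positions being counted bijectively onto
  \<open>{1..w i}\<close>. Hence comparisons of values alone determine a permutation.\<close>

lemma Sym_rank:
  assumes w: "w \<in> Sym n" and i: "i \<in> {1..n}"
  shows "w i = card {j \<in> {1..n}. w j \<le> w i}"
proof -
  have range: "w j \<in> {1..n} \<longleftrightarrow> j \<in> {1..n}" for j
    using w by (simp only: Sym_def mem_Collect_eq permutes_in_image)
  have "w ` {j \<in> {1..n}. w j \<le> w i} = {1..w i}"
  proof (intro equalityI subsetI)
    fix y assume "y \<in> w ` {j \<in> {1..n}. w j \<le> w i}"
    then obtain j where "y = w j" "j \<in> {1..n}" "w j \<le> w i" by blast
    then show "y \<in> {1..w i}" using range[of j] by simp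
  next
    fix y assume y: "y \<in> {1..w i}"
    have e: "w (inv w y) = y" by (rule Sym_inv_apply(1)[OF w])
    have "y \<in> {1..n}" using y range[of i] i by simp
    then have "inv w y \<in> {1..n}" using range[of "inv w y"] e by simp
    then have "inv w y \<in> {j \<in> {1..n}. w j \<le> w i}" using y e by simp
    then show "y \<in> w ` {j \<in> {1..n}. w j \<le> w i}" using e by (metis imageI)
  qed
  moreover have "card (w ` {j \<in> {1..n}. w j \<le> w i}) = card {j \<in> {1..n}. w j \<le> w i}"
    using w by (intro card_image inj_onI) (simp add: Sym_eq_iff)
  ultimately show ?thesis by simp
qed

lemma inversions_id [simp]: "inversions n id = {}"
  by (auto simp: inversions_def)

text \<open>The inversion set decides every comparison of two values, and these comparisons give the
  ranks in \<open>Sym_rank\<close>.\<close>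

lemma inversions_inj:
  assumes "x \<in> Sym n" "y \<in> Sym n" "inversions n x = inversions n y"
  shows "x = y"
proof
  fix i
  have lt: "x b < x a \<longleftrightarrow> y b < y a" if "a \<in> {1..n}" "b \<in> {1..n}" "a < b" for a b
    using assms(3) that unfolding inversions_def set_eq_iff
    by (metis (mono_tags, lifting) atLeastAtMost_iff case_prodI mem_Collect_eq case_prodD)
  have le: "x j \<le> x i \<longleftrightarrow> y j \<le> y i" if "i \<in> {1..n}" "j \<in> {1..n}" for j
    using lt[of i j] lt[of j i] that Sym_eq_iff[OF assms(1), of i j] Sym_eq_iff[OF assms(2), of i j]
    by (metis linorder_neqE_nat nat_less_le not_less)
  show "x i = y i"
  proof (cases "i \<in> {1..n}")
    case True
    then have "{j \<in> {1..n}. x j \<le> x i} = {j \<in> {1..n}. y j \<le> y i}" using le by blast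
    then show ?thesis using Sym_rank assms(1,2) True by metis
  next
    case False
    then show ?thesis using assms(1,2) by (metis Sym_def mem_Collect_eq permutes_not_in)
  qed
qed

lemma biconvex_inversions:
  assumes "w \<in> Sym n"
  shows "biconvex n (inversions n w)"
  using inversions_subset[of n w] Sym_eq_iff[OF assms]
  by (auto simp: biconvex_def inversions_def trans_def)

text \<open>Reversing the natural order on the pairs in \<open>S\<close> gives a strict total order;
  biconvexity is what makes it transitive. Ranking the positions in this order yields the
  permutation.\<close>

lemma biconvex_realize:
  assumes S: "biconvex n S"
  shows "\<exists>w \<in> Sym n. inversions n w = S"
proof -
  \<comment> \<open>\<open>L x y\<close> anticipates \<open>w x < w y\<close>.\<close>
  define L where "L x y \<longleftrightarrow> (x < y \<and> (x, y) \<notin> S) \<or> (y < x \<and> (y, x) \<in> S)" for x y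
  have sub: "1 \<le> x \<and> x < y \<and> y \<le> n" if "(x, y) \<in> S" for x y
    using that S by (auto simp: biconvex_def pairs_def)
  have tr: "(x, z) \<in> S" if "(x, y) \<in> S" "(y, z) \<in> S" for x y z
    using that S unfolding biconvex_def trans_def by blast
  have co: "(x, y) \<in> S \<or> (y, z) \<in> S" if "(x, z) \<in> S" "x < y" "y < z" for x y z
    using that S unfolding biconvex_def by blast
  have irr: "\<not> L x x" for x by (simp add: L_def)
  have tot: "L x y \<or> L y x" if "x \<noteq> y" for x y using that by (auto simp: L_def)
  have Ltr: "L x z" if "L x y" "L y z" for x y z
    using that tr[of x y z] tr[of z y x] tr[of y z x] tr[of y x z] tr[of z x y] tr[of x z y]
      co[of x y z] co[of z y x] co[of y z x] co[of y x z] co[of z x y] co[of x z y]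
    unfolding L_def by (metis linorder_neqE_nat less_trans order_less_irrefl)
  define B where "B x = {y \<in> {1..n}. y = x \<or> L y x}" for x
  define w where "w x = (if x \<in> {1..n} then card (B x) else x)" for x
  have fin: "finite (B x)" for x by (simp add: B_def)
  have mono: "w x < w y" if "x \<in> {1..n}" "y \<in> {1..n}" "L x y" for x y
  proof -
    have "B x \<subseteq> B y" using that Ltr unfolding B_def by blast
    moreover have "y \<in> B y" "y \<notin> B x" using that Ltr[of x y x] irr by (auto simp: B_def)
    ultimately have "B x \<subset> B y" by blast
    then show ?thesis using that fin by (simp add: w_def psubset_card_mono)
  qed
  have iff: "w x < w y \<longleftrightarrow> L x y" if "x \<in> {1..n}" "y \<in> {1..n}" for x y
    using mono that tot by (metis order_less_asym order_less_irrefl)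
  have inj: "inj_on w {1..n}"
    unfolding inj_on_def using iff tot by (metis order_less_irrefl)
  have "w x \<in> {1..n}" if "x \<in> {1..n}" for x
  proof -
    have "x \<in> B x" "B x \<subseteq> {1..n}" using that by (auto simp: B_def)
    then have "0 < card (B x)" "card (B x) \<le> card {1..n}"
      using fin card_gt_0_iff by (blast, intro card_mono) auto
    then show ?thesis using that by (simp add: w_def)
  qed
  then have "w ` {1..n} = {1..n}"
    using inj by (intro endo_inj_surj) auto
  then have "bij_betw w {1..n} {1..n}" using inj by (simp add: bij_betw_def)
  moreover have "w x = x" if "x \<notin> {1..n}" for x using that by (simp only: w_def if_False)
  ultimately have "w \<in> Sym n" unfolding Sym_def using bij_imp_permutes by blast
  moreover have "inversions n w = S"
  proof -
    have "(i, j) \<in> inversions n w \<longleftrightarrow> (i, j) \<in> S" for i j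
      using iff[of j i] sub[of i j] unfolding inversions_def L_def by auto
    then show ?thesis by auto
  qed
  ultimately show ?thesis by blast
qed

text \<open>A quick way to build permutations: keys may repeat, since positions with equal keys keep
  their natural order.\<close>

lemma key_realize:
  fixes c :: "nat \<Rightarrow> nat"
  shows "\<exists>w \<in> Sym n. inversions n w = {(x, y) \<in> pairs n. c y < c x}"
  by (rule biconvex_realize) (auto simp: biconvex_def trans_def pairs_def)

lemma biconvex_compl:
  assumes S: "biconvex n S"
  shows "biconvex n (pairs n - S)"
  unfolding biconvex_def
proof (intro conjI allI impI)
  show "trans (pairs n - S)"
  proof (rule transI)
    fix i j k assume h: "(i, j) \<in> pairs n - S" "(j, k) \<in> pairs n - S"
    then have "i < j" "j < k" "(i, k) \<in> pairs n" by (auto simp: pairs_def)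
    then show "(i, k) \<in> pairs n - S" using h S unfolding biconvex_def by blast
  qed
next
  fix i j k assume h: "(i, k) \<in> pairs n - S \<and> i < j \<and> j < k"
  then have "(i, j) \<in> pairs n" "(j, k) \<in> pairs n" by (auto simp: pairs_def)
  then show "(i, j) \<in> pairs n - S \<or> (j, k) \<in> pairs n - S"
    using h S unfolding biconvex_def trans_def by blast
qed blast

lemma trancl_increasing:
  assumes "(i, j) \<in> T\<^sup>+" "T \<subseteq> pairs n"
  shows "(i, j) \<in> pairs n"
  using assms by (induction rule: trancl_induct) (auto simp: pairs_def)

text \<open>In a path of steps from \<open>S\<close> and \<open>T\<close>, a point \<open>j\<close>
  between the ends is either visited or jumped over by one step. That step splits at
  \<open>j\<close>, which completes a path from \<open>i\<close> to \<open>j\<close> or one from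
  \<open>j\<close> to \<open>k\<close>. The induction treats the last step.\<close>

lemma biconvex_join:
  assumes S: "biconvex n S" and T: "biconvex n T"
  shows "biconvex n ((S \<union> T)\<^sup>+)"
proof -
  have sub: "S \<union> T \<subseteq> pairs n" using S T by (auto simp: biconvex_def)
  have co: "(i, j) \<in> S \<union> T \<or> (j, k) \<in> S \<union> T"
    if "(i, k) \<in> S \<union> T" "i < j" "j < k" for i j k
    using S T that unfolding biconvex_def by blast
  have "\<forall>j. i < j \<and> j < k \<longrightarrow> (i, j) \<in> (S \<union> T)\<^sup>+ \<or> (j, k) \<in> (S \<union> T)\<^sup>+"
    if "(i, k) \<in> (S \<union> T)\<^sup>+" for i k
    using that
  proof (induction rule: trancl_induct)
    case (base y)
    then show ?case using co by blast
  next
    case (step y z)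
    show ?case
    proof (intro allI impI)
      fix j assume j: "i < j \<and> j < z"
      consider "j < y" | "j = y" | "y < j" by linarith
      then show "(i, j) \<in> (S \<union> T)\<^sup>+ \<or> (j, z) \<in> (S \<union> T)\<^sup>+"
      proof cases
        case 1
        then show ?thesis using step j by (meson trancl.trancl_into_trancl)
      next
        case 2
        then show ?thesis using step by simp
      next
        case 3
        then show ?thesis using step j co[of y z j] by (meson r_into_trancl trancl.trancl_into_trancl)
      qed
    qed
  qed
  moreover have "(S \<union> T)\<^sup>+ \<subseteq> pairs n" using trancl_increasing[OF _ sub] by auto
  ultimately show ?thesis unfolding biconvex_def using trans_trancl by blast
qed

text \<open>Steps in \<open>T\<close> strictly increase, so a path of two or more steps cannot join
  consecutive numbers. This is what makes descents easy to follow through joins and meets.\<close>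

lemma adjacent_in_trancl_iff:
  assumes "T \<subseteq> pairs n"
  shows "(i, Suc i) \<in> T\<^sup>+ \<longleftrightarrow> (i, Suc i) \<in> T"
proof
  assume "(i, Suc i) \<in> T\<^sup>+"
  then show "(i, Suc i) \<in> T"
  proof (cases rule: trancl.cases)
    case (trancl_into_trancl y)
    then show ?thesis
      using trancl_increasing[of i y T n] assms by (auto simp: pairs_def)
  qed
qed auto

section \<open>Coxeter length and the left weak order\<close>

text \<open>The values \<open>x p\<close> and \<open>x q\<close> are inverted by
  \<open>y \<circ> inv x\<close> exactly when \<open>x\<close> and \<open>y\<close> order the
  positions \<open>p\<close> and \<open>q\<close> differently, so the symmetric difference is
  counted.\<close>

lemma card_inversions_quotient:
  assumes x: "x \<in> Sym n" and y: "y \<in> Sym n"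
  shows "card (inversions n (y \<circ> inv x)) =
    card (inversions n x - inversions n y) + card (inversions n y - inversions n x)"
proof -
  let ?D = "(inversions n x - inversions n y) \<union> (inversions n y - inversions n x)"
  \<comment> \<open>\<open>f\<close> passes from positions to their values under \<open>x\<close>
    and sorts the two, since \<open>inversions\<close> wants the smaller entry first.\<close>
  define f where "f = (\<lambda>(p, q). if x p < x q then (x p, x q) else (x q, x p))"
  have "bij_betw f ?D (inversions n (y \<circ> inv x))"
  proof (rule bij_betwI')
    fix a b assume "a \<in> ?D" "b \<in> ?D"
    then show "(f a = f b) = (a = b)"
      using Sym_eq_iff[OF x] by (auto simp: f_def inversions_def split: if_splits)
  next
    fix a assume a: "a \<in> ?D"
    obtain p q where [simp]: "a = (p, q)" by force
    have "1 \<le> p" "p < q" "q \<le> n" using a by (auto simp: inversions_def)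
    then show "f a \<in> inversions n (y \<circ> inv x)"
      using a Sym_eq_iff[OF x, of p q] Sym_eq_iff[OF y, of p q] Sym_range[OF x, of p] Sym_range[OF x, of q]
      by (auto simp: f_def inversions_def Sym_inv_apply[OF x])
  next
    fix b assume b: "b \<in> inversions n (y \<circ> inv x)"
    obtain i j where [simp]: "b = (i, j)" by force
    define p where "p = inv x i"
    define q where "q = inv x j"
    have [simp]: "x p = i" "x q = j" by (simp_all add: p_def q_def Sym_inv_apply[OF x])
    have ij: "1 \<le> i" "i < j" "j \<le> n" "y q < y p" using b by (auto simp: inversions_def p_def q_def)
    have r: "1 \<le> p \<and> p \<le> n" "1 \<le> q \<and> q \<le> n"
      using ij Sym_range[OF Sym_inv[OF x], of i] Sym_range[OF Sym_inv[OF x], of j]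
      by (auto simp: p_def q_def)
    have "p \<noteq> q" using ij by auto
    show "\<exists>a\<in>?D. b = f a"
    proof (cases "p < q")
      case True
      then show ?thesis using ij r by (intro bexI[of _ "(p, q)"]) (auto simp: f_def inversions_def)
    next
      case False
      then show ?thesis using ij r \<open>p \<noteq> q\<close>
        by (intro bexI[of _ "(q, p)"]) (auto simp: f_def inversions_def)
    qed
  qed
  then have "card (inversions n (y \<circ> inv x)) = card ?D" by (simp add: bij_betw_same_card)
  then show ?thesis using finite_inversions by (subst (asm) card_Un_disjoint) auto
qed

lemma simple_gen_in_Sym: "1 \<le> i \<Longrightarrow> i < n \<Longrightarrow> simple_gen i \<in> Sym n"
  by (simp add: Sym_def simple_gen_def permutes_swap_id)

lemma inversions_simple_gen:
  "1 \<le> i \<Longrightarrow> i < n \<Longrightarrow> inversions n (simple_gen i) = {(i, Suc i)}"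
  by (auto simp: inversions_def simple_gen_def transpose_def split: if_splits)

text \<open>Left multiplication exchanges the values \<open>k\<close> and \<open>Suc k\<close>. No
  third value lies between them, so only their own two positions change order.\<close>

lemma inversions_simple_gen_comp:
  assumes "w \<in> Sym n" "1 \<le> k" "k < n" "inv w k < inv w (Suc k)"
  shows "inversions n (simple_gen k \<circ> w) = insert (inv w k, inv w (Suc k)) (inversions n w)"
    "(inv w k, inv w (Suc k)) \<notin> inversions n w"
proof -
  define p where "p = inv w k"
  define q where "q = inv w (Suc k)"
  have wp [simp]: "w p = k" "w q = Suc k" by (simp_all add: p_def q_def Sym_inv_apply[OF assms(1)])
  have r: "1 \<le> p" "p < q" "q \<le> n"
    using assms Sym_range[OF Sym_inv[OF assms(1)], of k] Sym_range[OF Sym_inv[OF assms(1)], of "Suc k"]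
    by (auto simp: p_def q_def)
  have e: "w i = k \<longleftrightarrow> i = p" "w i = Suc k \<longleftrightarrow> i = q" for i
    using Sym_eq_iff[OF assms(1)] by (metis wp(1), metis wp(2))
  have "(i, j) \<in> inversions n (simple_gen k \<circ> w) \<longleftrightarrow> (i, j) \<in> insert (p, q) (inversions n w)" for i j
  proof (cases "1 \<le> i \<and> i < j \<and> j \<le> n")
    case True
    then have "w i \<noteq> w j" using Sym_eq_iff[OF assms(1), of i j] by simp
    then have "simple_gen k (w j) < simple_gen k (w i) \<longleftrightarrow>
        (w j < w i \<and> \<not> (w j = k \<and> w i = Suc k)) \<or> (w i = k \<and> w j = Suc k)"
      by (auto simp: simple_gen_def transpose_def)
    also have "\<dots> \<longleftrightarrow> w j < w i \<or> (i = p \<and> j = q)"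
      unfolding e using True r(2) by auto
    finally show ?thesis using True by (auto simp: inversions_def)
  qed (use r in \<open>auto simp: inversions_def\<close>)
  then show "inversions n (simple_gen k \<circ> w) = insert (inv w k, inv w (Suc k)) (inversions n w)"
    by (auto simp: p_def q_def)
  show "(inv w k, inv w (Suc k)) \<notin> inversions n w"
    using wp by (simp add: inversions_def p_def q_def)
qed

lemma inversions_simple_gen_comp_drop:
  assumes "w \<in> Sym n" "1 \<le> k" "k < n" "inv w (Suc k) < inv w k"
  shows "inversions n w = insert (inv w (Suc k), inv w k) (inversions n (simple_gen k \<circ> w))"
    "(inv w (Suc k), inv w k) \<notin> inversions n (simple_gen k \<circ> w)"
proof -
  let ?v = "simple_gen k \<circ> w"
  have v: "?v \<in> Sym n" using assms by (simp add: Sym_comp simple_gen_in_Sym)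
  have invol: "simple_gen k (simple_gen k i) = i" for i by (simp add: simple_gen_def)
  have "inv ?v i = inv w (simple_gen k i)" for i
    using Sym_eq_iff[OF v, of "inv ?v i" "inv w (simple_gen k i)"] invol
      Sym_inv_apply[OF v] Sym_inv_apply[OF assms(1)] by simp
  then have [simp]: "inv ?v k = inv w (Suc k)" "inv ?v (Suc k) = inv w k"
    by (simp_all add: simple_gen_def)
  have "simple_gen k \<circ> ?v = w" using invol by auto
  then show "inversions n w = insert (inv w (Suc k), inv w k) (inversions n ?v)"
    "(inv w (Suc k), inv w k) \<notin> inversions n ?v"
    using inversions_simple_gen_comp[OF v assms(2,3)] assms(4) by simp_all
qed

lemma no_left_descent_imp_id:
  assumes w: "w \<in> Sym n" and asc: "\<And>k. 1 \<le> k \<Longrightarrow> k < n \<Longrightarrow> inv w k < inv w (Suc k)"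
  shows "w = id"
proof -
  have mono: "i \<ge> 1 \<Longrightarrow> j \<le> n \<Longrightarrow> i < j \<Longrightarrow> inv w i < inv w j" for i j
  proof (induction j)
    case (Suc j)
    then show ?case using asc[of j] by (cases "i = j") auto
  qed simp
  have "inversions n (inv w) = inversions n id"
    using mono by (fastforce simp: inversions_def id_def)
  then have "inv w = id" using inversions_inj Sym_inv[OF w] id_in_Sym by blast
  then show ?thesis using w by (metis Sym_inv_apply(1) eq_id_iff)
qed

lemma word_prod_simps [simp]: "word_prod [] = id" "word_prod (s # ss) = s \<circ> word_prod ss"
  by (simp_all add: word_prod_def)

text \<open>Each further letter adds at most one inversion, which bounds the length of any word from
  below.\<close>

lemma word_prod_inversions:
  "set ss \<subseteq> simple_gens n \<Longrightarrow>
    word_prod ss \<in> Sym n \<and> card (inversions n (word_prod ss)) \<le> length ss"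
proof (induction ss)
  case Nil
  then show ?case by (simp add: id_in_Sym del: id_apply)
next
  case (Cons s ss)
  let ?w = "word_prod ss"
  obtain k where k: "s = simple_gen k" "1 \<le> k" "k < n"
    using Cons.prems by (auto simp: simple_gens_def)
  have w: "?w \<in> Sym n" "card (inversions n ?w) \<le> length ss" using Cons by auto
  have "inv ?w k \<noteq> inv ?w (Suc k)" using Sym_eq_iff[OF Sym_inv[OF w(1)]] by simp
  then consider "inv ?w k < inv ?w (Suc k)" | "inv ?w (Suc k) < inv ?w k" by linarith
  then have "card (inversions n (s \<circ> ?w)) \<le> Suc (card (inversions n ?w))"
  proof cases
    case 1
    then show ?thesis
      using inversions_simple_gen_comp[OF w(1) k(2,3)] k(1)
      by (simp add: finite_inversions)
  next
    case 2
    have "inversions n (s \<circ> ?w) \<subseteq> inversions n ?w"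
      using inversions_simple_gen_comp_drop(1)[OF w(1) k(2,3) 2] k(1) by auto
    then show ?thesis using card_mono[OF finite_inversions] le_Suc_eq by blast
  qed
  moreover have "s \<circ> ?w \<in> Sym n" using w k simple_gen_in_Sym Sym_comp by simp
  ultimately show ?case using w(2) by (simp del: o_apply)
qed

text \<open>The matching short word: a permutation other than \<open>id\<close> has a left descent,
  and undoing it removes exactly one inversion.\<close>

lemma exists_word:
  "w \<in> Sym n \<Longrightarrow>
    \<exists>ss. length ss = card (inversions n w) \<and> set ss \<subseteq> simple_gens n \<and> word_prod ss = w"
proof (induction "card (inversions n w)" arbitrary: w rule: less_induct)
  case less
  show ?case
  proof (cases "w = id")
    case True
    then show ?thesis by (intro exI[of _ "[]"]) simp
  next
    case False
    then obtain k where k: "1 \<le> k" "k < n" "\<not> inv w k < inv w (Suc k)"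
      using no_left_descent_imp_id less.prems by blast
    moreover have "inv w k \<noteq> inv w (Suc k)" using Sym_eq_iff[OF Sym_inv[OF less.prems]] by simp
    ultimately have "inv w (Suc k) < inv w k" by linarith
    note d = inversions_simple_gen_comp_drop[OF less.prems k(1,2) this]
    let ?v = "simple_gen k \<circ> w"
    have c: "card (inversions n w) = Suc (card (inversions n ?v))"
      unfolding d(1) using d(2) by (simp add: finite_inversions)
    moreover have "?v \<in> Sym n" using k less.prems by (simp add: Sym_comp simple_gen_in_Sym)
    ultimately obtain ss where ss: "length ss = card (inversions n ?v)" "set ss \<subseteq> simple_gens n"
        "word_prod ss = ?v"
      using less.hyps[of ?v] by auto
    have "simple_gen k \<circ> ?v = w" by (auto simp: simple_gen_def)
    then show ?thesis using ss c k
      by (intro exI[of _ "simple_gen k # ss"]) (auto simp: simple_gens_def)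
  qed
qed

lemma coxeter_length_eq:
  assumes "w \<in> Sym n"
  shows "coxeter_length n w = card (inversions n w)"
  unfolding coxeter_length_def
  by (rule Least_equality) (use exists_word[OF assms] word_prod_inversions in auto)

text \<open>By \<open>card_inversions_quotient\<close> the length of the quotient is the sum of the
  sizes of both differences. It equals the difference of the lengths only if no inversion of
  \<open>x\<close> is missing from \<open>y\<close>.\<close>

lemma left_weak_le_iff:
  assumes "x \<in> Sym n" "y \<in> Sym n"
  shows "left_weak_le n x y \<longleftrightarrow> inversions n x \<subseteq> inversions n y"
proof -
  let ?X = "inversions n x" and ?Y = "inversions n y"
  have "card ?X = card (?X - ?Y) + card (?X \<inter> ?Y)" "card ?Y = card (?Y - ?X) + card (?X \<inter> ?Y)"
    using card_Int_Diff[of ?X ?Y] card_Int_Diff[of ?Y ?X] finite_inversions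
    by (auto simp: Int_commute)
  then have "left_weak_le n x y \<longleftrightarrow> card (?X - ?Y) = 0"
    using assms coxeter_length_eq card_inversions_quotient[OF assms]
    by (simp add: left_weak_le_def Sym_comp Sym_inv)
  then show ?thesis using finite_inversions by auto
qed

text \<open>The quotient formula is applied to \<open>simple_gen i\<close>, an involution whose only
  inversion is \<open>(i, Suc i)\<close>.\<close>

lemma simple_gen_in_right_descents_iff:
  assumes "v \<in> Sym n" "1 \<le> i" "i < n"
  shows "simple_gen i \<in> right_descents n v \<longleftrightarrow> v (Suc i) < v i"
proof -
  have s: "simple_gen i \<in> Sym n" using assms by (simp add: simple_gen_in_Sym)
  have "inv (simple_gen i) = simple_gen i" by (simp add: simple_gen_def)
  then have "card (inversions n (v \<circ> simple_gen i)) =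
      card ({(i, Suc i)} - inversions n v) + card (inversions n v - {(i, Suc i)})"
    using card_inversions_quotient[OF s assms(1)] assms inversions_simple_gen by simp
  then have "coxeter_length n (v \<circ> simple_gen i) < coxeter_length n v \<longleftrightarrow>
      (i, Suc i) \<in> inversions n v"
    using assms s finite_inversions[of n v] card_gt_0_iff[of "inversions n v"]
    by (cases "(i, Suc i) \<in> inversions n v") (auto simp: coxeter_length_eq Sym_comp card_Diff_singleton_if)
  then show ?thesis using assms by (auto simp: right_descents_def simple_gens_def inversions_def)
qed

lemma simple_gen_inj:
  assumes "simple_gen i = simple_gen j" shows "i = j"
  using fun_cong[OF assms, of i] by (simp add: simple_gen_def transpose_def split: if_splits)

lemma card_right_descents:
  assumes "v \<in> Sym n"
  shows "card (right_descents n v) = card {i. 1 \<le> i \<and> i < n \<and> v (Suc i) < v i}"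
proof -
  have "right_descents n v = simple_gen ` {i. 1 \<le> i \<and> i < n \<and> v (Suc i) < v i}"
    using simple_gen_in_right_descents_iff[OF assms]
    by (auto simp: right_descents_def simple_gens_def)
  then show ?thesis using simple_gen_inj by (simp add: card_image inj_on_def)
qed

section \<open>Joins and meets in the left weak order\<close>

lemma left_weak_order_simps [simp]:
  "carrier (left_weak_order n) = Sym n" "le (left_weak_order n) = left_weak_le n"
  by (simp_all add: left_weak_order_def)

lemma trancl_subset_iff:
  assumes "trans V"
  shows "T\<^sup>+ \<subseteq> V \<longleftrightarrow> T \<subseteq> V"
proof
  assume "T \<subseteq> V"
  then show "T\<^sup>+ \<subseteq> V" using trancl_mono[of _ T V] trancl_id[OF assms] by auto
qed auto

text \<open>Inversion sets are transitive, so an upper bound of both sets contains the transitive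
  closure of their union, and that closure is itself biconvex.\<close>

lemma join_left_weak_order:
  assumes x: "x \<in> Sym n" and y: "y \<in> Sym n"
  shows "x \<squnion>\<^bsub>left_weak_order n\<^esub> y \<in> Sym n"
    "inversions n (x \<squnion>\<^bsub>left_weak_order n\<^esub> y) = (inversions n x \<union> inversions n y)\<^sup>+"
proof -
  let ?L = "left_weak_order n" and ?T = "(inversions n x \<union> inversions n y)\<^sup>+"
  obtain z where z: "z \<in> Sym n" "inversions n z = ?T"
    using biconvex_realize biconvex_join biconvex_inversions x y by metis
  have up: "v \<in> Upper ?L {x, y} \<longleftrightarrow> v \<in> Sym n \<and> inversions n z \<subseteq> inversions n v" for v
  proof -
    have "?T \<subseteq> inversions n v \<longleftrightarrow> inversions n x \<union> inversions n y \<subseteq> inversions n v" if "v \<in> Sym n"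
      using biconvex_inversions[OF that] by (intro trancl_subset_iff) (simp add: biconvex_def)
    then show ?thesis using x y z by (auto simp: Upper_def left_weak_le_iff)
  qed
  have "least ?L z (Upper ?L {x, y})"
    unfolding least_def using up z by (auto simp: left_weak_le_iff)
  \<comment> \<open>The library join is a choice among least upper bounds, so exhibiting one
    transfers the property to the chosen element.\<close>
  then have "least ?L (x \<squnion>\<^bsub>?L\<^esub> y) (Upper ?L {x, y})"
    unfolding join_def sup_def by (rule someI[where P = "\<lambda>s. is_lub ?L s {x, y}"])
  then show "x \<squnion>\<^bsub>?L\<^esub> y \<in> Sym n" "inversions n (x \<squnion>\<^bsub>?L\<^esub> y) = ?T"
    using z up[of z] up[of "x \<squnion>\<^bsub>?L\<^esub> y"] left_weak_le_iff[of "x \<squnion>\<^bsub>?L\<^esub> y" n z]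
    by (auto simp: least_def)
qed

text \<open>Dual to joins: complementation in \<open>pairs n\<close> reverses inclusion and
  preserves biconvexity.\<close>

lemma meet_left_weak_order:
  assumes x: "x \<in> Sym n" and y: "y \<in> Sym n"
  shows "x \<sqinter>\<^bsub>left_weak_order n\<^esub> y \<in> Sym n"
    "inversions n (x \<sqinter>\<^bsub>left_weak_order n\<^esub> y) =
      pairs n - ((pairs n - inversions n x) \<union> (pairs n - inversions n y))\<^sup>+"
proof -
  let ?L = "left_weak_order n" and ?C = "\<lambda>v. pairs n - inversions n v"
  let ?T = "(?C x \<union> ?C y)\<^sup>+"
  have bic: "biconvex n ?T"
    using biconvex_join biconvex_compl biconvex_inversions x y by metis
  then obtain z where z: "z \<in> Sym n" "inversions n z = pairs n - ?T"
    using biconvex_realize biconvex_compl by metis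
  have lo: "v \<in> Lower ?L {x, y} \<longleftrightarrow> v \<in> Sym n \<and> inversions n v \<subseteq> inversions n z" for v
  proof -
    have "?T \<subseteq> ?C v \<longleftrightarrow> ?C x \<union> ?C y \<subseteq> ?C v" if "v \<in> Sym n"
      using biconvex_compl[OF biconvex_inversions[OF that]]
      by (intro trancl_subset_iff) (simp add: biconvex_def)
    moreover have "?T \<subseteq> pairs n" using bic by (simp add: biconvex_def)
    moreover have "?T \<subseteq> ?C v \<longleftrightarrow> inversions n v \<subseteq> pairs n - ?T"
      using inversions_subset[of n v] \<open>?T \<subseteq> pairs n\<close> by blast
    moreover have "?C a \<subseteq> ?C v \<longleftrightarrow> inversions n v \<subseteq> inversions n a" for a
      using inversions_subset[of n v] inversions_subset[of n a] by blast
    ultimately have z_iff: "inversions n v \<subseteq> inversions n z \<longleftrightarrow>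
        inversions n v \<subseteq> inversions n x \<and> inversions n v \<subseteq> inversions n y" if "v \<in> Sym n"
      using that z(2) by simp
    have "v \<in> Lower ?L {x, y} \<longleftrightarrow>
        v \<in> Sym n \<and> inversions n v \<subseteq> inversions n x \<and> inversions n v \<subseteq> inversions n y"
      unfolding Lower_def left_weak_order_simps mem_Collect_eq Int_iff
      using x y left_weak_le_iff[of v n] by (metis insert_iff empty_iff)
    then show ?thesis using z_iff by metis
  qed
  have "greatest ?L z (Lower ?L {x, y})"
    unfolding greatest_def using lo z(1) left_weak_le_iff[OF _ z(1)] Lower_closed[of ?L "{x, y}"]
    by simp
  then have "greatest ?L (x \<sqinter>\<^bsub>?L\<^esub> y) (Lower ?L {x, y})"
    unfolding meet_def inf_def by (rule someI[where P = "\<lambda>s. is_glb ?L s {x, y}"])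
  then show "x \<sqinter>\<^bsub>?L\<^esub> y \<in> Sym n" "inversions n (x \<sqinter>\<^bsub>?L\<^esub> y) = pairs n - ?T"
    using z lo[of z] lo[of "x \<sqinter>\<^bsub>?L\<^esub> y"] left_weak_le_iff[of z n "x \<sqinter>\<^bsub>?L\<^esub> y"]
    by (auto simp: greatest_def)
qed

lemma inversions_join_least:
  assumes "x \<in> Sym n" "y \<in> Sym n" "v \<in> Sym n"
    "inversions n x \<subseteq> inversions n v" "inversions n y \<subseteq> inversions n v"
  shows "inversions n (x \<squnion>\<^bsub>left_weak_order n\<^esub> y) \<subseteq> inversions n v"
proof -
  have "trans (inversions n v)" using biconvex_inversions[OF assms(3)] by (simp add: biconvex_def)
  then show ?thesis using assms by (simp add: join_left_weak_order trancl_subset_iff)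
qed

lemma inversions_join_upper:
  assumes "x \<in> Sym n" "y \<in> Sym n"
  shows "inversions n x \<union> inversions n y \<subseteq> inversions n (x \<squnion>\<^bsub>left_weak_order n\<^esub> y)"
  using assms by (auto simp: join_left_weak_order)

lemma inversions_meet_lower:
  assumes "x \<in> Sym n" "y \<in> Sym n"
  shows "inversions n (x \<sqinter>\<^bsub>left_weak_order n\<^esub> y) \<subseteq> inversions n x \<inter> inversions n y"
  using assms by (auto simp: meet_left_weak_order)

lemma join_absorb:
  assumes "x \<in> Sym n" "y \<in> Sym n" "inversions n x \<subseteq> inversions n y"
  shows "x \<squnion>\<^bsub>left_weak_order n\<^esub> y = y"
  using assms inversions_join_upper[of x n y] inversions_join_least[of x n y y]
  by (intro inversions_inj[where n = n] join_left_weak_order) auto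

lemma inversions_meet_greatest:
  assumes "x \<in> Sym n" "y \<in> Sym n" "v \<in> Sym n"
    "inversions n v \<subseteq> inversions n x" "inversions n v \<subseteq> inversions n y"
  shows "inversions n v \<subseteq> inversions n (x \<sqinter>\<^bsub>left_weak_order n\<^esub> y)"
proof -
  let ?C = "pairs n - inversions n v"
  have "trans ?C" using biconvex_compl[OF biconvex_inversions[OF assms(3)]] by (simp add: biconvex_def)
  then have "((pairs n - inversions n x) \<union> (pairs n - inversions n y))\<^sup>+ \<subseteq> ?C"
    using assms(4,5) by (simp only: trancl_subset_iff) blast
  then show ?thesis using assms inversions_subset[of n v] by (auto simp: meet_left_weak_order)
qed

lemma meet_absorb:
  assumes "x \<in> Sym n" "y \<in> Sym n" "inversions n x \<subseteq> inversions n y"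
  shows "x \<sqinter>\<^bsub>left_weak_order n\<^esub> y = x"
  using assms inversions_meet_lower[of x n y] inversions_meet_greatest[of x n y x]
  by (intro inversions_inj[where n = n] meet_left_weak_order) auto

section \<open>Lattice congruences and the least elements of their classes\<close>

lemma lattice_congruence_left_weak_orderD:
  assumes "lattice_congruence (left_weak_order n) R"
  shows "(x, y) \<in> R \<Longrightarrow> x \<in> Sym n \<and> y \<in> Sym n"
    "x \<in> Sym n \<Longrightarrow> (x, x) \<in> R"
    "(x, y) \<in> R \<Longrightarrow> (y, x) \<in> R"
    "(x, y) \<in> R \<Longrightarrow> (y, z) \<in> R \<Longrightarrow> (x, z) \<in> R"
    "(x, y) \<in> R \<Longrightarrow> (x', y') \<in> R \<Longrightarrow>
      (x \<sqinter>\<^bsub>left_weak_order n\<^esub> x', y \<sqinter>\<^bsub>left_weak_order n\<^esub> y') \<in> R"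
    "(x, y) \<in> R \<Longrightarrow> (x', y') \<in> R \<Longrightarrow>
      (x \<squnion>\<^bsub>left_weak_order n\<^esub> x', y \<squnion>\<^bsub>left_weak_order n\<^esub> y') \<in> R"
proof -
  have e: "equiv (Sym n) R" using assms by (simp add: lattice_congruence_def)
  show "(x, y) \<in> R \<Longrightarrow> x \<in> Sym n \<and> y \<in> Sym n"  using e by (auto simp: equiv_def)
  show "x \<in> Sym n \<Longrightarrow> (x, x) \<in> R" using e by (auto simp: equiv_def refl_on_def)
  show "(x, y) \<in> R \<Longrightarrow> (y, x) \<in> R" using e by (auto simp: equiv_def sym_def)
  show "(x, y) \<in> R \<Longrightarrow> (y, z) \<in> R \<Longrightarrow> (x, z) \<in> R" using e by (auto simp: equiv_def trans_def)
qed (use assms in \<open>auto simp: lattice_congruence_def\<close>)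

text \<open>Classes are order convex: joining \<open>x\<close> and \<open>z\<close> with
  \<open>y\<close> relates \<open>y\<close> to \<open>z\<close>.\<close>

lemma congruence_interval:
  assumes R: "lattice_congruence (left_weak_order n) R" and xz: "(x, z) \<in> R" and y: "y \<in> Sym n"
    and le: "inversions n x \<subseteq> inversions n y" "inversions n y \<subseteq> inversions n z"
  shows "(x, y) \<in> R"
proof -
  note D = lattice_congruence_left_weak_orderD[OF R]
  have s: "x \<in> Sym n" "z \<in> Sym n" using D(1) xz by auto
  have "(x \<squnion>\<^bsub>left_weak_order n\<^esub> y, z \<squnion>\<^bsub>left_weak_order n\<^esub> y) \<in> R" using D(2,6) xz y by blast
  then have "(y, z \<squnion>\<^bsub>left_weak_order n\<^esub> y) \<in> R" using join_absorb s y le by simp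
  then have "(y \<sqinter>\<^bsub>left_weak_order n\<^esub> z, (z \<squnion>\<^bsub>left_weak_order n\<^esub> y) \<sqinter>\<^bsub>left_weak_order n\<^esub> z) \<in> R"
    using D(2,5) s by blast
  moreover have "z \<squnion>\<^bsub>left_weak_order n\<^esub> y = z"
    using s y le inversions_join_upper[of z n y] inversions_join_least[of z n y z]
    by (intro inversions_inj[where n = n] join_left_weak_order) auto
  ultimately have "(y, z) \<in> R" using meet_absorb s y le by auto
  then show ?thesis using D xz by blast
qed

text \<open>The definition of \<open>pi_down\<close> asks only for a minimal element. A class is
  closed under meets, so a member with fewest inversions lies below all others and is the only
  minimal one.\<close>

lemma pi_down_least:
  assumes R: "lattice_congruence (left_weak_order n) R" and w: "w \<in> Sym n"
  shows "(w, pi_down n R w) \<in> R" "(w, v) \<in> R \<Longrightarrow> inversions n (pi_down n R w) \<subseteq> inversions n v"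
proof -
  note D = lattice_congruence_left_weak_orderD[OF R]
  have "\<exists>u. (w, u) \<in> R \<and> (\<forall>v. (w, v) \<in> R \<longrightarrow> card (inversions n u) \<le> card (inversions n v))"
    using ex_has_least_nat[of "\<lambda>u. (w, u) \<in> R" w "\<lambda>u. card (inversions n u)"] D(2)[OF w] by blast
  then obtain u where u: "(w, u) \<in> R"
    and least: "\<And>v. (w, v) \<in> R \<Longrightarrow> card (inversions n u) \<le> card (inversions n v)" by blast
  have us: "u \<in> Sym n" using D(1) u by blast
  have min: "inversions n u \<subseteq> inversions n v" if v: "(w, v) \<in> R" for v
  proof -
    have vs: "v \<in> Sym n" using D(1) v by blast
    let ?m = "u \<sqinter>\<^bsub>left_weak_order n\<^esub> v"
    have "?m \<in> Sym n" "inversions n ?m \<subseteq> inversions n u \<inter> inversions n v"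
      using us vs meet_left_weak_order inversions_meet_lower by auto
    moreover have "(u, ?m) \<in> R"
      using D(5)[OF D(2)[OF us] D(4)[OF D(3)[OF u] v]] meet_absorb[OF us us] by simp
    then have "card (inversions n u) \<le> card (inversions n ?m)" using least D(4) u by blast
    ultimately have "inversions n ?m = inversions n u"
      using card_subset_eq[OF finite_inversions] card_mono[OF finite_inversions]
      by (metis le_antisym le_inf_iff)
    then show ?thesis using \<open>inversions n ?m \<subseteq> _\<close> by blast
  qed
  have "pi_down n R w = u"
    unfolding pi_down_def
  proof (rule the_equality)
    show "u \<in> R `` {w} \<and> (\<forall>v\<in>R `` {w}. left_weak_le n v u \<longrightarrow> v = u)"
      using u min us D(1) inversions_inj left_weak_le_iff by (metis Image_singleton_iff subset_antisym)
  next
    fix u' assume u': "u' \<in> R `` {w} \<and> (\<forall>v\<in>R `` {w}. left_weak_le n v u' \<longrightarrow> v = u')"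
    then have "u' \<in> Sym n" "inversions n u \<subseteq> inversions n u'" using D(1) min by auto
    then show "u' = u" using u' u left_weak_le_iff[OF us] by (metis Image_singleton_iff)
  qed
  then show "(w, pi_down n R w) \<in> R"
    "(w, v) \<in> R \<Longrightarrow> inversions n (pi_down n R w) \<subseteq> inversions n v"
    using u min by auto
qed

section \<open>Arcs and forcing between contracted covers\<close>

text \<open>For \<open>1 \<le> a < b \<le> n\<close> these are the inversion sets of the
  join-irreducible permutations. \<open>S\<close> records which points between \<open>a\<close> and
  \<open>b\<close> take a larger value than \<open>a\<close>; its other members have no
  effect.\<close>

definition arc :: "nat \<Rightarrow> nat \<Rightarrow> nat set \<Rightarrow> (nat \<times> nat) set" where
  "arc a b S = {(x, y). a \<le> x \<and> x < y \<and> y \<le> b \<and> (x = a \<or> x \<in> S) \<and> (y = b \<or> y \<notin> S)}"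

lemma biconvex_arc:
  assumes "1 \<le> a" "b \<le> n"
  shows "biconvex n (arc a b S)"
  using assms unfolding biconvex_def
proof (intro conjI allI impI)
  show "trans (arc a b S)" by (auto simp: arc_def trans_def)
next
  fix i j k assume "(i, k) \<in> arc a b S \<and> i < j \<and> j < k"
  then show "(i, j) \<in> arc a b S \<or> (j, k) \<in> arc a b S" by (cases "j \<in> S") (auto simp: arc_def)
qed (auto simp: arc_def pairs_def)

text \<open>Every right end \<open>y\<close> has \<open>(a, y)\<close> inverted. If
  \<open>(a, x)\<close> is not inverted, biconvexity at \<open>x\<close> then forces
  \<open>(x, y)\<close>.\<close>

lemma arc_subset_inversions:
  assumes v: "v \<in> Sym n" and ab: "(a, b) \<in> inversions n v"
  shows "arc a b {z. (a, z) \<notin> inversions n v} \<subseteq> inversions n v"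
proof -
  have co: "(i, j) \<in> inversions n v \<or> (j, k) \<in> inversions n v"
    if "(i, k) \<in> inversions n v" "i < j" "j < k" for i j k
    using biconvex_inversions[OF v] that unfolding biconvex_def by blast
  show ?thesis
  proof (intro subrelI)
    fix x y assume xy: "(x, y) \<in> arc a b {z. (a, z) \<notin> inversions n v}"
    then have ay: "(a, y) \<in> inversions n v" using ab by (auto simp: arc_def)
    show "(x, y) \<in> inversions n v"
    proof (cases "x = a")
      case False
      then show ?thesis using xy co[OF ay, of x] by (auto simp: arc_def)
    qed (use ay in simp)
  qed
qed

text \<open>The permutation \<open>y\<close> in the proof contains all of the arc of \<open>(p, q)\<close> except \<open>(p, q)\<close> itself,
  and its join with that arc contains the arc of \<open>(a, b)\<close>, whereas \<open>(a, b)\<close> is not an inversion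
  of \<open>y\<close>. So contracting the first arc also contracts the second.\<close>

lemma arc_forcing:
  assumes R: "lattice_congruence (left_weak_order n) R"
    and uv: "(u, v) \<in> R" "inversions n v = insert (p, q) (inversions n u)"
      "(p, q) \<notin> inversions n u"
    and st: "s \<in> Sym n" "t \<in> Sym n" "inversions n t = insert (a, b) (inversions n s)"
      "(a, b) \<notin> inversions n s"
    and sub: "a \<le> p" "q \<le> b"
    and agree: "\<And>z. p < z \<Longrightarrow> z < q \<Longrightarrow> (p, z) \<in> inversions n v \<longleftrightarrow> (a, z) \<in> inversions n t"
  shows "(s, t) \<in> R"
proof -
  let ?L = "left_weak_order n"
  note D = lattice_congruence_left_weak_orderD[OF R]
  have u: "u \<in> Sym n" and v: "v \<in> Sym n" using D(1) uv(1) by auto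
  have pq: "1 \<le> p" "p < q" "q \<le> n" "(p, q) \<in> inversions n v"
    and ab: "1 \<le> a" "a < b" "b \<le> n" "(a, b) \<in> inversions n t"
    using inversions_subset[of n v] inversions_subset[of n t] uv(2) st(3) by (auto simp: pairs_def)
  define S where "S = {z. (p, z) \<notin> inversions n v}"
  define T where "T = {z. (a, z) \<notin> inversions n t}"
  have ST: "z \<in> S \<longleftrightarrow> z \<in> T" if "p < z" "z < q" for z using agree that by (simp add: S_def T_def)
  obtain j where j: "j \<in> Sym n" "inversions n j = arc p q S"
    using biconvex_realize biconvex_arc pq by metis
  obtain k where k: "k \<in> Sym n" "inversions n k = arc a b T"
    using biconvex_realize biconvex_arc ab by metis
  \<comment> \<open>Points of \<open>T\<close> get the top key and the remaining points the bottom
    key. The end points lie between, ordered so that \<open>(a, p)\<close> and \<open>(q, b)\<close>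
    become inversions when nondegenerate, while \<open>(p, q)\<close> and \<open>(a, b)\<close> do
    not. If \<open>a = p\<close> or \<open>q = b\<close>, the earlier test decides.\<close>
  define c :: "nat \<Rightarrow> nat" where
    "c z = (if z = p then 1 else if z = a then 2 else if z = b then 3 else if z = q then 4
      else if z \<in> T then 5 else 0)" for z
  obtain y where y: "y \<in> Sym n" "inversions n y = {(x, z) \<in> pairs n. c z < c x}"
    using key_realize by blast
  have jv: "inversions n j \<subseteq> inversions n v"
    unfolding j S_def using arc_subset_inversions[OF v] pq by simp
  have kt: "inversions n k \<subseteq> inversions n t"
    unfolding k T_def using arc_subset_inversions[OF st(2)] ab by simp
  \<comment> \<open>Meeting the contracted cover with \<open>j\<close> relates \<open>j\<close> to
    \<open>?ju\<close>, which lacks \<open>(p, q)\<close>.\<close>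
  let ?ju = "j \<sqinter>\<^bsub>?L\<^esub> u"
  have ju: "?ju \<in> Sym n" using j u by (simp add: meet_left_weak_order)
  have "(?ju, j \<sqinter>\<^bsub>?L\<^esub> v) \<in> R" using D(5)[OF D(2)[OF j(1)] uv(1)] .
  then have ju_j: "(?ju, j) \<in> R" using meet_absorb[OF j(1) v jv] by simp
  have "inversions n ?ju \<subseteq> inversions n y"
  proof (intro subrelI)
    fix x z assume "(x, z) \<in> inversions n ?ju"
    then have xz: "(x, z) \<in> arc p q S" "(x, z) \<noteq> (p, q)"
      using inversions_meet_lower[OF j(1) u] j(2) uv(3) by auto
    then have "(x, z) \<in> pairs n" using j(2) inversions_subset by blast
    moreover have "c z < c x" using xz sub ST[of x] ST[of z] by (cases "x = p"; cases "z = q") (auto simp: arc_def c_def)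
    ultimately show "(x, z) \<in> inversions n y" using y(2) by simp
  qed
  then have "?ju \<squnion>\<^bsub>?L\<^esub> y = y" using join_absorb ju y(1) by blast
  then have yM: "(y, j \<squnion>\<^bsub>?L\<^esub> y) \<in> R" using D(6)[OF ju_j D(2)[OF y(1)]] by simp
  let ?M = "j \<squnion>\<^bsub>?L\<^esub> y"
  have M: "?M \<in> Sym n" using D(1) yM by blast
  have M_up: "inversions n j \<subseteq> inversions n ?M" "inversions n y \<subseteq> inversions n ?M"
    using inversions_join_upper[OF j(1) y(1)] by auto
  have M_trans: "(x, z) \<in> inversions n ?M"
    if "(x, x') \<in> inversions n ?M" "(x', z) \<in> inversions n ?M" for x x' z
    using biconvex_inversions[OF M] that unfolding biconvex_def trans_def by blast
  have "inversions n k \<subseteq> inversions n ?M"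
  proof (intro subrelI)
    fix x z assume xz: "(x, z) \<in> inversions n k"
    then have arc: "(x, z) \<in> arc a b T" and pr: "(x, z) \<in> pairs n"
      using k(2) inversions_subset by auto
    show "(x, z) \<in> inversions n ?M"
    proof (cases "c z < c x")
      case True
      then show ?thesis using y(2) pr M_up by blast
    next
      case False
      \<comment> \<open>The pairs left run from \<open>a\<close> or \<open>p\<close> to
        \<open>b\<close> or \<open>q\<close>. They are composed of the steps \<open>a\<close> to
        \<open>p\<close>, \<open>p\<close> to \<open>q\<close> and \<open>q\<close> to
        \<open>b\<close>.\<close>
      have pqM: "(p, q) \<in> inversions n ?M" using M_up(1) j(2) pq by (auto simp: arc_def)
      have xz: "x = a \<or> x = p" "z = b \<or> z = q"
        using False arc sub pq by (auto simp: arc_def c_def split: if_splits)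
      have "(a, p) \<in> inversions n ?M" if "a \<noteq> p"
        using that y(2) sub pq ab by (intro subsetD[OF M_up(2)]) (auto simp: pairs_def c_def)
      then have xq: "(x, q) \<in> inversions n ?M" using xz(1) pqM M_trans[of a p q] by auto
      have "(q, b) \<in> inversions n ?M" if "q \<noteq> b"
        using that y(2) sub pq ab by (intro subsetD[OF M_up(2)]) (auto simp: pairs_def c_def)
      then show ?thesis using xz(2) xq M_trans[of x q b] by auto
    qed
  qed
  then have "k \<sqinter>\<^bsub>?L\<^esub> ?M = k" using meet_absorb k(1) M by blast
  then have ky_k: "(k \<sqinter>\<^bsub>?L\<^esub> y, k) \<in> R" using D(5)[OF D(2)[OF k(1)] yM] by simp
  let ?ky = "k \<sqinter>\<^bsub>?L\<^esub> y"
  have ky: "?ky \<in> Sym n" using D(1) ky_k by blast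
  have "(a, b) \<notin> inversions n y" using y(2) ab pq sub by (auto simp: c_def)
  then have "e \<in> inversions n ?ky \<Longrightarrow> e \<in> inversions n t \<and> e \<noteq> (a, b)" for e
    using subsetD[OF inversions_meet_lower[OF k(1) y(1)], of e] subsetD[OF kt, of e] by auto
  then have "inversions n ?ky \<subseteq> inversions n s" unfolding st(3) by blast
  then have "?ky \<squnion>\<^bsub>?L\<^esub> s = s" using join_absorb ky st(1) by blast
  \<comment> \<open>Joining with \<open>s\<close> carries the relation between \<open>?ky\<close>
    and \<open>k\<close> to the cover of \<open>s\<close> by \<open>t\<close>.\<close>
  moreover have "k \<squnion>\<^bsub>?L\<^esub> s = t"
  proof (rule inversions_inj[where n = n])
    have "inversions n (k \<squnion>\<^bsub>?L\<^esub> s) \<subseteq> inversions n t"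
      using inversions_join_least[OF k(1) st(1,2) kt] st(3) by blast
    moreover have "(a, b) \<in> inversions n k" using k(2) ab by (simp add: arc_def)
    ultimately show "inversions n (k \<squnion>\<^bsub>?L\<^esub> s) = inversions n t"
      using inversions_join_upper[OF k(1) st(1)] unfolding st(3) by (intro equalityI) auto
  qed (use k st in \<open>simp_all add: join_left_weak_order\<close>)
  ultimately show ?thesis using D(6)[OF ky_k D(2)[OF st(1)]] by simp
qed

text \<open>If \<open>q = Suc p\<close>, no point lies between them and the agreement in
  \<open>arc_forcing\<close> is vacuous. The contraction would then relate \<open>id\<close> to
  \<open>simple_gen p\<close>, against the singleton class.\<close>

lemma essential_cover_not_adjacent:
  assumes R: "essential_congruence n R"
    and uv: "(u, v) \<in> R" "inversions n v = insert (p, q) (inversions n u)"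
      "(p, q) \<notin> inversions n u"
  shows "Suc p < q"
proof (rule ccontr)
  have L: "lattice_congruence (left_weak_order n) R" and e: "R `` {id} = {id}"
    using R by (auto simp: essential_congruence_def)
  note D = lattice_congruence_left_weak_orderD[OF L]
  have v: "v \<in> Sym n" using D(1) uv(1) by blast
  have pq: "1 \<le> p" "p < q" "q \<le> n"
    using inversions_subset[of n v] uv(2) by (auto simp: pairs_def)
  assume "\<not> Suc p < q"
  then have q: "q = Suc p" using pq by simp
  have t: "simple_gen p \<in> Sym n" "inversions n (simple_gen p) = {(p, q)}"
    using pq q simple_gen_in_Sym inversions_simple_gen by auto
  have "(id, simple_gen p) \<in> R"
    by (rule arc_forcing[OF L uv id_in_Sym t(1), of p q]) (use t q in auto)
  then have "simple_gen p = id" using e by blast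
  then show False using t(2) by (simp del: id_apply)
qed

section \<open>Counting contracted ascents and the upper bound\<close>

text \<open>Members of \<open>D\<close> are charged injectively to descents of \<open>x\<close> with
  a side, so there are at most twice as many as descents. Both kinds share \<open>n - 1\<close>
  positions. The assumption \<open>between\<close> isolates what arc forcing provides.\<close>

lemma card_contracted_ascents_le:
  assumes x: "x \<in> Sym n"
    and D: "D \<subseteq> {i. 1 \<le> i \<and> i < n \<and> x i < x (Suc i)}"
    and gap: "\<And>i. i \<in> D \<Longrightarrow> Suc (x i) < x (Suc i)"
    and between: "\<And>i k. \<lbrakk>i \<in> D; 1 \<le> k; k < n; x (Suc k) \<le> x i; x (Suc i) \<le> x k\<rbrakk> \<Longrightarrow>
      \<exists>m. (Suc i < m \<and> m < k \<or> Suc k < m \<and> m < i) \<and> x i < x m \<and> x m < x (Suc i)"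
  shows "3 * card D \<le> 2 * (n - 1)"
proof -
  define K where "K = {k. 1 \<le> k \<and> k < n \<and> x (Suc k) < x k}"
  \<comment> \<open>The flag \<open>t\<close> is the side. For \<open>True\<close> the walk goes
    right from \<open>Suc i\<close>, stays at or above \<open>x (Suc i)\<close> up to
    \<open>k\<close>, and enters the gap at \<open>Suc k\<close>. For \<open>False\<close> it goes
    left from \<open>i\<close>, stays at or below \<open>x i\<close> down to \<open>Suc k\<close>,
    and enters the gap at \<open>k\<close>.\<close>
  define P where "P i tk = (case tk of (t, k) \<Rightarrow>
    (if t then i < k \<and> x i < x (Suc k) \<and> x (Suc k) < x (Suc i) \<and>
        (\<forall>m. i < m \<and> m \<le> k \<longrightarrow> x (Suc i) \<le> x m)
      else k < i \<and> x i < x k \<and> x k < x (Suc i) \<and>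
        (\<forall>m. k < m \<and> m \<le> i \<longrightarrow> x m \<le> x i)))" for i tk
  have ex: "\<exists>tk. tk \<in> UNIV \<times> K \<and> P i tk" if i: "i \<in> D" for i
  proof -
    have i': "1 \<le> i" "i < n" "x i < x (Suc i)" using D i by auto
    have dich: "x m \<le> x i \<or> x (Suc i) \<le> x m" if "\<not> (x i < x m \<and> x m < x (Suc i))" for m
      using that by linarith
    let ?b = "\<lambda>m. m \<le> n \<and> 1 \<le> m \<and> x i < x m \<and> x m < x (Suc i)"
    \<comment> \<open>The value \<open>Suc (x i)\<close> lies in the gap, so its position
      serves.\<close>
    have "\<exists>m. ?b m"
    proof -
      have "1 \<le> Suc (x i) \<and> Suc (x i) \<le> n"
        using gap[OF i] Sym_range[OF x, of "Suc i"] i' by auto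
      then show ?thesis
        using Sym_range[OF Sym_inv[OF x], of "Suc (x i)"] gap[OF i] Sym_inv_apply[OF x]
        by (intro exI[of _ "inv x (Suc (x i))"]) auto
    qed
    then obtain m where m: "?b m" by blast
    then have "m \<noteq> i" "m \<noteq> Suc i" by auto
    show ?thesis
    proof (cases "\<exists>m. ?b m \<and> Suc i < m")
      case True
      then have ex: "\<exists>m. ?b m \<and> Suc i < m" .
      define l where "l = (LEAST m. ?b m \<and> Suc i < m)"
      have l: "?b l" "Suc i < l" unfolding l_def using LeastI_ex[OF ex] by auto
      have least: "\<not> (?b m \<and> Suc i < m)" if "m < l" for m
        using that not_less_Least unfolding l_def by blast
      \<comment> \<open>Before the first gap position \<open>l\<close> the walk cannot drop across
        the whole gap: \<open>between\<close> would supply a gap position earlier than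
        \<open>l\<close>.\<close>
      have high: "Suc i \<le> m \<Longrightarrow> m < l \<longrightarrow> x (Suc i) \<le> x m" for m
      proof (induction rule: dec_induct)
        case (step m)
        show ?case
        proof
          assume ml: "Suc m < l"
          show "x (Suc i) \<le> x (Suc m)"
          proof (rule ccontr)
            assume "\<not> x (Suc i) \<le> x (Suc m)"
            moreover have "\<not> ?b (Suc m)" using least[OF ml] step by simp
            ultimately have "x (Suc m) \<le> x i" using l(1) ml by auto
            then obtain m' where "Suc i < m' \<and> m' < m \<or> Suc m < m' \<and> m' < i" "x i < x m'" "x m' < x (Suc i)"
              using between[OF i, of m] step ml l by auto
            then show False using least[of m'] step ml l by auto
          qed
        qed
      qed simp
      obtain k where k: "l = Suc k" using l by (cases l) auto
      have "k \<in> K" using high[of k] l k i' by (auto simp: K_def)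
      moreover have "P i (True, k)" using high l k by (auto simp: P_def)
      ultimately show ?thesis by blast
    next
      case False
      then have "\<not> Suc i < m" using m by blast
      then have "m < i" using \<open>m \<noteq> i\<close> \<open>m \<noteq> Suc i\<close> by linarith
      define A where "A = {m. ?b m \<and> m < i}"
      have A: "finite A" "A \<noteq> {}"
        using m \<open>m < i\<close> by (auto simp: A_def)
      define g where "g = Max A"
      have g: "?b g" "g < i" using Max_in[OF A] by (auto simp: g_def A_def)
      have greatest: "\<not> (?b m \<and> m < i)" if "g < m" for m
        using that Max_ge[OF A(1), of m] unfolding g_def[symmetric] by (simp add: A_def) blast
      \<comment> \<open>The mirror image: going left, a jump across the gap would give a gap
        position between \<open>g\<close> and \<open>i\<close>.\<close>
      have low: "m \<le> i \<Longrightarrow> g < m \<longrightarrow> x m \<le> x i" for m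
      proof (induction rule: inc_induct)
        case (step m)
        show ?case
        proof
          assume gm: "g < m"
          show "x m \<le> x i"
          proof (rule ccontr)
            assume "\<not> x m \<le> x i"
            moreover have "\<not> ?b m" using greatest[OF gm] step by simp
            ultimately have "x (Suc i) \<le> x m" using g gm i' step by auto
            then obtain m' where "Suc i < m' \<and> m' < m \<or> Suc m < m' \<and> m' < i" "x i < x m'" "x m' < x (Suc i)"
              using between[OF i, of m] step gm g i' by auto
            then show False using greatest[of m'] step gm g i' by auto
          qed
        qed
      qed simp
      have "g \<in> K" using low[of "Suc g"] g i' by (auto simp: K_def)
      moreover have "P i (False, g)" using low g by (auto simp: P_def)
      ultimately show ?thesis by blast
    qed
  qed
  define f where "f i = (SOME tk. tk \<in> UNIV \<times> K \<and> P i tk)" for i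
  have f: "f i \<in> UNIV \<times> K \<and> P i (f i)" if "i \<in> D" for i
    unfolding f_def by (rule someI_ex) (rule ex[OF that])
  have P_inj: "\<not> i < i'" if "P i tk" "P i' tk" for i i' tk
  proof
    \<comment> \<open>With the same side and descent, one walk passes the start of the other, which
      gives \<open>x (Suc i) \<le> x i'\<close>. But \<open>x i'\<close> is below the gap value at
      the descent, and that value is below \<open>x (Suc i)\<close>.\<close>
    assume "i < i'"
    obtain t k where [simp]: "tk = (t, k)" by force
    show False
    proof (cases t)
      case True
      then have "x (Suc i) \<le> x i'" "x i' < x (Suc k)" "x (Suc k) < x (Suc i)"
        using that \<open>i < i'\<close> by (auto simp: P_def)
      then show False by simp
    next
      case False
      then have "x (Suc i) \<le> x i'" "x i' < x k" "x k < x (Suc i)"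
        using that \<open>i < i'\<close> by (auto simp: P_def)
      then show False by simp
    qed
  qed
  have "inj_on f D"
  proof (rule inj_onI)
    fix i i' assume "i \<in> D" "i' \<in> D" "f i = f i'"
    then show "i = i'" using f P_inj by (metis linorder_neqE_nat)
  qed
  moreover have K: "K \<subseteq> {1..<n}" "D \<subseteq> {1..<n}" using D by (auto simp: K_def)
  then have fin: "finite K" "finite D" using finite_subset by blast+
  ultimately have "card D \<le> card ((UNIV :: bool set) \<times> K)"
    using f by (intro card_inj_on_le[of f] image_subsetI) auto
  then have "card D \<le> 2 * card K" by (simp add: card_cartesian_product)
  moreover have "card D + card K \<le> n - 1"
  proof -
    have "D \<inter> K = {}" using D by (auto simp: K_def)
    then have "card D + card K = card (D \<union> K)" using fin by (simp add: card_Un_disjoint)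
    also have "\<dots> \<le> card {1..<n}" using K by (intro card_mono) auto
    finally show ?thesis by simp
  qed
  ultimately show ?thesis by linarith
qed

text \<open>The counting bound is applied to the inverse \<open>x\<close> of the least class
  element, with \<open>D\<close> the descents of \<open>w \<circ> x\<close>.\<close>

lemma stack_sort_descents_le:
  assumes R: "essential_congruence n R" and w: "w \<in> Sym n"
  shows "3 * card (right_descents n (stack_sort n R w)) \<le> 2 * (n - 1)"
proof -
  have L: "lattice_congruence (left_weak_order n) R"
    using R by (simp add: essential_congruence_def)
  define u where "u = pi_down n R w"
  define x where "x = inv u"
  have wu: "(w, u) \<in> R" "(w, v) \<in> R \<Longrightarrow> inversions n u \<subseteq> inversions n v" for v
    using pi_down_least[OF L w] by (auto simp: u_def)
  note C = lattice_congruence_left_weak_orderD[OF L]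
  have u: "u \<in> Sym n" using C(1) wu(1) by blast
  have x: "x \<in> Sym n" using u by (simp add: x_def Sym_inv)
  have ux [simp]: "u (x i) = i" for i by (simp add: x_def Sym_inv_apply[OF u])
  have uw: "inversions n u \<subseteq> inversions n w" using wu(2) C(2)[OF w] by blast
  define D where "D = {i. 1 \<le> i \<and> i < n \<and> w (x (Suc i)) < w (x i)}"
  \<comment> \<open>If \<open>x i > x (Suc i)\<close>, the pair would be an inversion of
    \<open>u\<close>, hence of \<open>w\<close>, which contradicts the descent. So
    \<open>simple_gen i \<circ> u\<close> adds one pair inverted by \<open>w\<close>; it lies
    between \<open>u\<close> and \<open>w\<close>, and convexity puts it in the class.\<close>
  have up: "x i < x (Suc i)" "(u, simple_gen i \<circ> u) \<in> R"
    "inversions n (simple_gen i \<circ> u) = insert (x i, x (Suc i)) (inversions n u)"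
    "(x i, x (Suc i)) \<notin> inversions n u" if i: "i \<in> D" for i
  proof -
    have i': "1 \<le> i" "i < n" "w (x (Suc i)) < w (x i)" using i by (auto simp: D_def)
    have r: "1 \<le> x i" "x i \<le> n" "1 \<le> x (Suc i)" "x (Suc i) \<le> n"
      using Sym_range[OF x, of i] Sym_range[OF x, of "Suc i"] i' by auto
    show asc: "x i < x (Suc i)"
    proof (rule ccontr)
      assume "\<not> x i < x (Suc i)"
      moreover have "x i \<noteq> x (Suc i)" using Sym_eq_iff[OF x] by simp
      ultimately have "(x (Suc i), x i) \<in> inversions n u" using r by (auto simp: inversions_def)
      then show False using uw i' by (auto simp: inversions_def)
    qed
    then show e: "inversions n (simple_gen i \<circ> u) = insert (x i, x (Suc i)) (inversions n u)"
      "(x i, x (Suc i)) \<notin> inversions n u"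
      using inversions_simple_gen_comp[OF u i'(1,2)] by (simp_all add: x_def)
    have "(x i, x (Suc i)) \<in> inversions n w" using asc r i' by (auto simp: inversions_def)
    then have "inversions n (simple_gen i \<circ> u) \<subseteq> inversions n w" using e uw by auto
    moreover have "simple_gen i \<circ> u \<in> Sym n" using i' u by (simp add: Sym_comp simple_gen_in_Sym)
    moreover have "inversions n u \<subseteq> inversions n (simple_gen i \<circ> u)" unfolding e(1) by auto
    ultimately show "(u, simple_gen i \<circ> u) \<in> R"
      by (intro congruence_interval[OF L C(3)[OF wu(1)]])
  qed
  have "3 * card D \<le> 2 * (n - 1)"
  proof (rule card_contracted_ascents_le[OF x])
    show "D \<subseteq> {i. 1 \<le> i \<and> i < n \<and> x i < x (Suc i)}" using up(1) by (auto simp: D_def)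
    show "Suc (x i) < x (Suc i)" if "i \<in> D" for i
      using essential_cover_not_adjacent[OF R up(2-4)] that by blast
    fix i k assume i: "i \<in> D" and k: "1 \<le> k" "k < n" "x (Suc k) \<le> x i" "x (Suc i) \<le> x k"
    note U = up[OF i]
    let ?s = "simple_gen k \<circ> u"
    have s: "?s \<in> Sym n" using k u by (simp add: Sym_comp simple_gen_in_Sym)
    have "x (Suc k) < x k" using k U(1) by simp
    note drop = inversions_simple_gen_comp_drop[OF u k(1,2), folded x_def, OF this]
    \<comment> \<open>Contracting this cover would put an element strictly below \<open>u\<close>
      into the class. Hence \<open>arc_forcing\<close> must fail, and only its agreement condition
      can be violated.\<close>
    have "(?s, u) \<notin> R"
    proof
      assume "(?s, u) \<in> R"
      then have "inversions n u \<subseteq> inversions n ?s" using wu C by blast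
      then show False using drop by blast
    qed
    then obtain z where z: "x i < z" "z < x (Suc i)"
      "\<not> ((x i, z) \<in> inversions n (simple_gen i \<circ> u) \<longleftrightarrow> (x (Suc k), z) \<in> inversions n u)"
      using arc_forcing[OF L U(2-4) s u drop k(3,4)] by blast
    have zn: "1 \<le> x i" "1 \<le> x (Suc k)" "z \<le> n"
      using Sym_range[OF x, of i] Sym_range[OF x, of "Suc k"] Sym_range[OF x, of "Suc i"] i k z(2)
      by (auto simp: D_def)
    have xu: "x (u z) = z" by (simp add: x_def Sym_inv_apply[OF u])
    \<comment> \<open>Both memberships compare the position \<open>u z\<close> with a threshold,
      \<open>i\<close> or \<open>Suc k\<close>. Disagreement places \<open>u z\<close> between the
      two adjacent pairs of positions.\<close>
    have "(x i, z) \<in> inversions n (simple_gen i \<circ> u) \<longleftrightarrow> u z < i"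
      using U(3) z zn by (auto simp: inversions_def)
    moreover have "(x (Suc k), z) \<in> inversions n u \<longleftrightarrow> u z < Suc k"
      using z zn k by (auto simp: inversions_def)
    ultimately have "\<not> (u z < i \<longleftrightarrow> u z < Suc k)" using z by simp
    moreover have "u z \<noteq> i" "u z \<noteq> Suc i" "u z \<noteq> k" "u z \<noteq> Suc k" using xu z k by auto
    ultimately have "Suc i < u z \<and> u z < k \<or> Suc k < u z \<and> u z < i" by linarith
    then show "\<exists>m. (Suc i < m \<and> m < k \<or> Suc k < m \<and> m < i) \<and> x i < x m \<and> x m < x (Suc i)"
      using xu z by (intro exI[of _ "u z"]) simp
  qed
  moreover have "card (right_descents n (stack_sort n R w)) = card D"
    unfolding stack_sort_def u_def[symmetric] x_def[symmetric] D_def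
    by (simp add: card_right_descents Sym_comp w x)
  ultimately show ?thesis by simp
qed

section \<open>The descent congruence and the lower bound\<close>

text \<open>The kernel of the descent set map onto a Boolean lattice; adjacent pairs in the
  inversion set encode right descents.\<close>

definition descent_congruence :: "nat \<Rightarrow> ((nat \<Rightarrow> nat) \<times> (nat \<Rightarrow> nat)) set" where
  "descent_congruence n = {(x, y) \<in> Sym n \<times> Sym n.
     \<forall>i. (i, Suc i) \<in> inversions n x \<longleftrightarrow> (i, Suc i) \<in> inversions n y}"

text \<open>With its dual below, this makes taking descent sets a lattice homomorphism.\<close>

lemma adjacent_in_inversions_join_iff:
  assumes "x \<in> Sym n" "y \<in> Sym n"
  shows "(i, Suc i) \<in> inversions n (x \<squnion>\<^bsub>left_weak_order n\<^esub> y) \<longleftrightarrow>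
    (i, Suc i) \<in> inversions n x \<or> (i, Suc i) \<in> inversions n y"
  using inversions_subset[of n x] inversions_subset[of n y]
  by (simp add: join_left_weak_order assms adjacent_in_trancl_iff[where n = n])

lemma adjacent_in_inversions_meet_iff:
  assumes "x \<in> Sym n" "y \<in> Sym n"
  shows "(i, Suc i) \<in> inversions n (x \<sqinter>\<^bsub>left_weak_order n\<^esub> y) \<longleftrightarrow>
    (i, Suc i) \<in> inversions n x \<and> (i, Suc i) \<in> inversions n y"
proof -
  have "(i, Suc i) \<in> ((pairs n - inversions n x) \<union> (pairs n - inversions n y))\<^sup>+ \<longleftrightarrow>
      (i, Suc i) \<in> (pairs n - inversions n x) \<union> (pairs n - inversions n y)"
    by (rule adjacent_in_trancl_iff[where n = n]) auto
  then show ?thesis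
    using inversions_subset[of n x] by (auto simp: meet_left_weak_order assms)
qed

text \<open>The class of \<open>id\<close> is a singleton because a permutation without right
  descents is the identity.\<close>

lemma essential_descent_congruence: "essential_congruence n (descent_congruence n)"
proof -
  have "equiv (Sym n) (descent_congruence n)"
    by (auto simp: descent_congruence_def equiv_def refl_on_def sym_def trans_def)
  then have "lattice_congruence (left_weak_order n) (descent_congruence n)"
    by (auto simp: lattice_congruence_def descent_congruence_def join_left_weak_order(1)
        meet_left_weak_order(1) adjacent_in_inversions_join_iff adjacent_in_inversions_meet_iff)
  moreover have "x = id" if x: "(id, x) \<in> descent_congruence n" for x
  proof -
    have xs: "x \<in> Sym n" and asc: "(k, Suc k) \<notin> inversions n x" for k
      using x by (auto simp: descent_congruence_def simp del: id_apply)
    have bij: "bij x" using xs by (auto simp: Sym_def permutes_bij)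
    have "x k < x (Suc k)" if "1 \<le> k" "k < n" for k
      using asc[of k] that Sym_eq_iff[OF xs, of k "Suc k"] by (auto simp: inversions_def)
    then have "inv x = id"
      using no_left_descent_imp_id[OF Sym_inv[OF xs]] by (simp add: inv_inv_eq[OF bij])
    then show ?thesis using inv_inv_eq[OF bij] by (simp add: inv_id)
  qed
  moreover have "(id, id) \<in> descent_congruence n"
    by (auto simp: descent_congruence_def id_in_Sym simp del: id_apply)
  ultimately show ?thesis by (auto simp: essential_congruence_def simp del: id_apply)
qed

text \<open>Sorting the chosen \<open>w\<close> leaves descents at the positions congruent to 0
  modulo 3 and, if two more positions follow, at those congruent to 1.\<close>

lemma stack_sort_descent_congruence_ge:
  "\<exists>w \<in> Sym n. 2 * (n - 1) div 3 \<le> card (right_descents n (stack_sort n (descent_congruence n) w))"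
proof -
  let ?R = "descent_congruence n"
  have L: "lattice_congruence (left_weak_order n) ?R"
    using essential_descent_congruence by (simp add: essential_congruence_def)
  \<comment> \<open>\<open>u\<close> swaps \<open>z\<close> and \<open>z + 1\<close> for
    \<open>z\<close> congruent to 2 modulo 3, leaving \<open>n\<close> fixed if it has no partner.
    It will be the least element of the class of \<open>w\<close>.\<close>
  define u where "u z = (if z mod 3 = 2 \<and> z < n then z + 1
    else if z mod 3 = 0 \<and> 1 \<le> z \<and> z \<le> n then z - 1 else z)" for z
  have Suc_mod: "Suc z mod 3 = 0" if "z mod 3 = 2" for z :: nat
    using that by (simp add: mod_Suc)
  have pred_mod: "(z - Suc 0) mod 3 = 2" if "z mod 3 = 0" "0 < z" for z :: nat
    using that by (cases z) (auto simp: mod_Suc split: if_splits)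
  have invol: "u (u z) = z" for z by (auto simp: u_def Suc_mod pred_mod)
  have outside: "u z = z" if "z \<notin> {1..n}" for z using that by (auto simp: u_def)
  have inv_u: "inv u = u" using invol by (intro inv_unique_comp) auto
  have us: "u \<in> Sym n"
  proof -
    have "\<exists>!z. u z = y" for y by (rule ex1I[of _ "u y"]) (auto simp: invol)
    then show ?thesis using outside by (simp add: Sym_def permutes_def)
  qed
  have Iu: "inversions n u = {(i, j). 1 \<le> i \<and> j = Suc i \<and> j \<le> n \<and> i mod 3 = 2}"
  proof -
    have "u j < u i \<longleftrightarrow> j = Suc i \<and> i mod 3 = 2" if "1 \<le> i" "i < j" "j \<le> n" for i j
      using that Suc_mod[of i] pred_mod[of j] by (auto simp: u_def split: if_splits)
    then show ?thesis by (auto simp: inversions_def)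
  qed
  obtain w where w: "w \<in> Sym n" "inversions n w = {(x, y) \<in> pairs n. y mod 3 < x mod 3}"
    using key_realize[of n "\<lambda>z. z mod 3"] by blast
  have adj: "(i, Suc i) \<in> inversions n w \<longleftrightarrow> (i, Suc i) \<in> inversions n u" for i
  proof -
    have "Suc i mod 3 < i mod 3 \<longleftrightarrow> i mod 3 = 2" by (auto simp: mod_Suc)
    then show ?thesis by (auto simp: w Iu pairs_def)
  qed
  have wu: "(w, u) \<in> ?R" using adj w(1) us by (auto simp: descent_congruence_def)
  let ?p = "pi_down n ?R w"
  have p: "(w, ?p) \<in> ?R" "inversions n ?p \<subseteq> inversions n u" using pi_down_least[OF L w(1)] wu by auto
  \<comment> \<open>All inversions of \<open>u\<close> are adjacent pairs, and these are shared by
    the whole class.\<close>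
  moreover have "inversions n u \<subseteq> inversions n ?p"
    using p(1) adj by (auto simp: descent_congruence_def Iu)
  ultimately have "?p = u"
    using us by (intro inversions_inj[where n = n]) (auto simp: descent_congruence_def)
  then have e: "stack_sort n ?R w = w \<circ> u" by (simp add: stack_sort_def inv_u)
  let ?D = "{i. 1 \<le> i \<and> i < n \<and> (w \<circ> u) (Suc i) < (w \<circ> u) i}"
  have D: "i \<in> ?D" if i: "1 \<le> i" "i < n" "i mod 3 = 1 \<and> i + 2 \<le> n \<or> i mod 3 = 0" for i
    using i(3)
  proof
    assume m: "i mod 3 = 1 \<and> i + 2 \<le> n"
    then have "u i = i" "u (Suc i) = i + 2" by (auto simp: u_def mod_Suc)
    moreover have "(i, i + 2) \<in> inversions n w" using m i(1) by (auto simp: w pairs_def mod_Suc)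
    ultimately show ?thesis using i by (auto simp: inversions_def)
  next
    assume m: "i mod 3 = 0"
    then have "u i = i - 1" "u (Suc i) = Suc i" using i by (auto simp: u_def mod_Suc)
    moreover have "2 \<le> i" using m i(1) by (cases "i = 1") auto
    then have "(i - 1, Suc i) \<in> inversions n w"
      using m i pred_mod[of i] by (auto simp: w pairs_def mod_Suc)
    ultimately show ?thesis using i by (auto simp: inversions_def)
  qed
  \<comment> \<open>\<open>?f\<close> enumerates 1, 3, 4, 6, 7, 9 and so on, the positive numbers
    not congruent to 2 modulo 3.\<close>
  let ?f = "\<lambda>j::nat. (3 * j + 1) div 2 + 1"
  have "?f ` {..<2 * (n - 1) div 3} \<subseteq> ?D"
  proof
    fix i assume "i \<in> ?f ` {..<2 * (n - 1) div 3}"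
    then obtain j where j: "j < 2 * (n - 1) div 3" "i = ?f j" by auto
    consider k where "j = 2 * k" | k where "j = 2 * k + 1" using oddE evenE by blast
    then have "1 \<le> i \<and> i < n \<and> (i mod 3 = 1 \<and> i + 2 \<le> n \<or> i mod 3 = 0)"
    proof cases
      case 1
      then have "i = Suc (3 * k)" using j(2) by simp
      then show ?thesis using j(1) 1 by (auto simp: mod_Suc)
    next
      case 2
      then have "i = 3 * (k + 1)" using j(2) by simp
      then show ?thesis using j(1) 2 by auto
    qed
    then show "i \<in> ?D" by (elim conjE) (rule D)
  qed
  moreover have "finite ?D" by simp
  ultimately have "card (?f ` {..<2 * (n - 1) div 3}) \<le> card ?D" by (intro card_mono)
  moreover have "card (?f ` {..<2 * (n - 1) div 3}) = 2 * (n - 1) div 3"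
  proof -
    have "strict_mono ?f" unfolding strict_mono_Suc_iff by presburger
    then have "inj_on ?f A" for A using strict_mono_imp_inj_on inj_on_subset by blast
    then show ?thesis by (simp add: card_image)
  qed
  ultimately show ?thesis
    using w(1) e card_right_descents[OF Sym_comp[OF w(1) us]] by (intro bexI[of _ w]) auto
qed

theorem theorem5p5:
  fixes n :: nat
  assumes "n \<ge> 1"
  shows "int (MAX R \<in> {R. essential_congruence n R}.
                MAX w \<in> Sym n. card (right_descents n (stack_sort n R w)))
           = \<lfloor>2 * (real n - 1) / 3\<rfloor>"
proof -
  let ?N = "2 * (n - 1) div 3"
  let ?A = "{R. essential_congruence n R}"
  let ?d = "\<lambda>R w. card (right_descents n (stack_sort n R w))"
  \<comment> \<open>Finiteness of the set of congruences is needed for the outer \<open>MAX\<close>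
    to be meaningful.\<close>
  have "?A \<subseteq> Pow (Sym n \<times> Sym n)"
    using lattice_congruence_left_weak_orderD(1) by (fastforce simp: essential_congruence_def)
  then have finA: "finite ?A" using finite_subset finite_Sym by blast
  have le: "(MAX w \<in> Sym n. ?d R w) \<le> ?N" if "R \<in> ?A" for R
    using stack_sort_descents_le[of n R] that finite_Sym[of n] id_in_Sym[of n]
    by (intro Max.boundedI) (fastforce simp: less_eq_div_iff_mult_less_eq)+
  let ?R = "descent_congruence n"
  have R: "?R \<in> ?A" using essential_descent_congruence by simp
  obtain w where w: "w \<in> Sym n" "?N \<le> ?d ?R w" using stack_sort_descent_congruence_ge by blast
  have "?d ?R w \<le> (MAX w \<in> Sym n. ?d ?R w)" using w(1) finite_Sym[of n] by (intro Max_ge) auto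
  also have "\<dots> \<le> (MAX R \<in> ?A. MAX w \<in> Sym n. ?d R w)" using R finA by (intro Max_ge) auto
  finally have "?N \<le> (MAX R \<in> ?A. MAX w \<in> Sym n. ?d R w)" using w(2) by simp
  moreover have "(MAX R \<in> ?A. MAX w \<in> Sym n. ?d R w) \<le> ?N"
    using R finA le by (intro Max.boundedI) auto
  ultimately have "(MAX R \<in> ?A. MAX w \<in> Sym n. ?d R w) = ?N" by simp
  \<comment> \<open>Natural division is the floor here, and \<open>n \<ge> 1\<close> keeps the
    truncated \<open>n - 1\<close> equal to the real difference.\<close>
  moreover have "\<lfloor>2 * (real n - 1) / 3\<rfloor> = int ?N"
    using floor_divide_of_nat_eq[of "2 * (n - 1)" 3] assms by (simp add: of_nat_diff)
  ultimately show ?thesis by simp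
qed

end
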